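(* Let $\mathbf{A}$ be an algebra; all relations below are binary relations on $\mathbf{A}$. Each of the following conditions implies all the conditions below it: (i) $R \subseteq [R, R^\circ|1]$ for every reflexive compatible relation $R$. (ia) $R^* \subseteq [R, R^\circ|1]$ for every reflexive compatible relation $R$. (ib) $R^- \subseteq [R, R^\circ|1]$ for every reflexive compatible relation $R$. (ic) $R^\circ \subseteq [R, R^\circ|1]$ for every reflexive compatible relation $R$. (id) $Cg(R) = [R, R^\circ|1]$ for every reflexive compatible relation $R$. (ii) $R \cap T \subseteq [R, T|1]$ for every tolerance $T$ and every reflexive compatible relation $R$. (iii) $(R_1 \circ R_2)\cap T \subseteq \big(T \cap (R_2^- \circ (T \cap (R_1^- \circ R_1)) \circ R_2)\big)^*$ for every tolerance $T$ and all reflexive compatible relations $R_1$, $R_2$. (iv) $R_1 \cap (T \circ R_2) \subseteq \big(T \cap (R_2 \circ (T \cap (R_1^- \circ R_1)) \circ R_2^-)\big)^* \circ R_2$ for every tolerance $T$ and all reflexive compatible relations $R_1$, $R_2$. (v) $\beta \cap (T \circ S) \subseteq \big(T \cap (S \circ (T \cap \beta) \circ S)\big)^* \circ S$ for every congruence $\beta$ and all tolerances $T, S$. (vi) $\beta \cap (T \circ \gamma) \subseteq \gamma \vee (T \cap \beta)^*$ for all congruences $\beta, \gamma$ and every tolerance $T$. Moreover, conditions (i), (ia), (ib), (ic), (id) and (ii) are equivalent for every algebra $\mathbf{A}$.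
   Context: A binary relation on an algebra $\mathbf{A}$ (with base set $A$) is called compatible (or admissible) if it is preserved by all operations of $\mathbf{A}$ applied coordinatewise. A tolerance is a reflexive, symmetric, compatible relation. For binary relations $R,S$ on $A$: $a\,(R\circ S)\,c$ iff there is $b\in A$ with $a\,R\,b\,S\,c$; $R^-$ is the converse of $R$; $R^*$ is the transitive closure of $R$; $R^\circ$ (superscript) is the smallest tolerance containing $R$; $Cg(R)$ is the smallest congruence containing $R$; $\vee$ is join in the lattice of congruences of $\mathbf{A}$ (for a tolerance $T$ and a congruence $\beta$, $(T\cap\beta)^*$ is a congruence). For compatible and reflexive relations $R,S$ on $\mathbf{A}$, $M(R,S)$ is the set of all matrices of the form $$\begin{vmatrix} t(\overline{a},\overline{b}) & t(\overline{a},\overline{b}\,') \\ t(\overline{a}\,',\overline{b}) & t(\overline{a}\,',\overline{b}\,')\end{vmatrix}$$ where $\overline{a},\overline{a}\,'\in A^n$, $\overline{b},\overline{b}\,'\in A^m$ for some $m,n\ge 0$, $t$ is an $(m+n)$-ary term operation of $\mathbf{A}$, and $\overline{a}\,R\,\overline{a}\,'$, $\overline{b}\,S\,\overline{b}\,'$ (componentwise). The commutator $[R,S|1]$ is the transitive closure of the set $$\left\{(z,w) \;\middle|\; \begin{vmatrix} x & x\\ z & w\end{vmatrix}\in M(R,S) \text{ for some } x\in A\right\}.$$ *)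

theory Defs
  imports Main
begin

text \<open>The operation symbols form a set rather than the whole type \<open>'f\<close>, so that an algebra may
  have no operations at all. The functions \<open>interp \<A> f\<close> are only meaningful on lists of
  length \<open>arity \<A> f\<close> over the carrier; nullary operations are allowed, and nothing excludes an
  empty carrier.\<close>

record ('f, 'a) alg =
  carrier :: "'a set"
  symbols :: "'f set"
  arity :: "'f \<Rightarrow> nat"
  interp :: "'f \<Rightarrow> 'a list \<Rightarrow> 'a"

definition algebra :: "('f, 'a) alg \<Rightarrow> bool" where
  "algebra \<A> \<longleftrightarrow>
     (\<forall>f\<in>symbols \<A>. \<forall>xs. length xs = arity \<A> f \<longrightarrow> set xs \<subseteq> carrier \<A>
        \<longrightarrow> interp \<A> f xs \<in> carrier \<A>)"

datatype 'f trm = Var nat | App 'f "'f trm list"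

text \<open>\<open>is_term \<A> n t\<close>: \<open>t\<close> is a term in the variables \<open>Var 0, \<dots>, Var (n - 1)\<close>; the
  \<open>n\<close>-ary term operations are then the functions \<open>\<lambda>xs. eval \<A> xs t\<close> on lists of
  length \<open>n\<close> over the carrier.\<close>

fun is_term :: "('f, 'a) alg \<Rightarrow> nat \<Rightarrow> 'f trm \<Rightarrow> bool" where
  "is_term \<A> n (Var i) \<longleftrightarrow> i < n"
| "is_term \<A> n (App f ts) \<longleftrightarrow>
     f \<in> symbols \<A> \<and> length ts = arity \<A> f \<and> (\<forall>t\<in>set ts. is_term \<A> n t)"

primrec eval :: "('f, 'a) alg \<Rightarrow> 'a list \<Rightarrow> 'f trm \<Rightarrow> 'a" where
  "eval \<A> xs (Var i) = xs ! i"
| "eval \<A> xs (App f ts) = interp \<A> f (map (eval \<A> xs) ts)"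

abbreviation related :: "'a rel \<Rightarrow> 'a list \<Rightarrow> 'a list \<Rightarrow> bool" where
  "related R \<equiv> list_all2 (\<lambda>x y. (x, y) \<in> R)"

definition compatible :: "('f, 'a) alg \<Rightarrow> 'a rel \<Rightarrow> bool" where
  "compatible \<A> R \<longleftrightarrow> R \<subseteq> carrier \<A> \<times> carrier \<A> \<and>
     (\<forall>f\<in>symbols \<A>. \<forall>xs ys. length xs = arity \<A> f \<longrightarrow> related R xs ys
        \<longrightarrow> (interp \<A> f xs, interp \<A> f ys) \<in> R)"

definition refl_compatible :: "('f, 'a) alg \<Rightarrow> 'a rel \<Rightarrow> bool" where
  "refl_compatible \<A> R \<longleftrightarrow> refl_on (carrier \<A>) R \<and> compatible \<A> R"

definition tolerance :: "('f, 'a) alg \<Rightarrow> 'a rel \<Rightarrow> bool" where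
  "tolerance \<A> T \<longleftrightarrow> refl_on (carrier \<A>) T \<and> sym T \<and> compatible \<A> T"

definition congruence :: "('f, 'a) alg \<Rightarrow> 'a rel \<Rightarrow> bool" where
  "congruence \<A> \<theta> \<longleftrightarrow> equiv (carrier \<A>) \<theta> \<and> compatible \<A> \<theta>"

text \<open>For \<open>R\<close> contained in the square of the carrier, the following two intersections are the least
  tolerance and the least congruence containing \<open>R\<close>; see the lemmas below.\<close>

definition tol :: "('f, 'a) alg \<Rightarrow> 'a rel \<Rightarrow> 'a rel" where
  "tol \<A> R = \<Inter> {T. tolerance \<A> T \<and> R \<subseteq> T}"

definition Cg :: "('f, 'a) alg \<Rightarrow> 'a rel \<Rightarrow> 'a rel" where
  "Cg \<A> R = \<Inter> {\<theta>. congruence \<A> \<theta> \<and> R \<subseteq> \<theta>}"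

definition con_join :: "('f, 'a) alg \<Rightarrow> 'a rel \<Rightarrow> 'a rel \<Rightarrow> 'a rel" where
  "con_join \<A> \<beta> \<gamma> = Cg \<A> (\<beta> \<union> \<gamma>)"

text \<open>A tuple \<open>(p, q, r, s)\<close> stands for the matrix with first row \<open>p, q\<close> and second row
  \<open>r, s\<close>. The entries of the argument lists lie in the carrier because \<open>R\<close> and \<open>S\<close> are
  relations on the carrier.\<close>

definition matrices :: "('f, 'a) alg \<Rightarrow> 'a rel \<Rightarrow> 'a rel \<Rightarrow> ('a \<times> 'a \<times> 'a \<times> 'a) set" where
  "matrices \<A> R S =
     {(eval \<A> (a @ b) t, eval \<A> (a @ b') t, eval \<A> (a' @ b) t, eval \<A> (a' @ b') t) | t a a' b b'.
        is_term \<A> (length a + length b) t \<and> related R a a' \<and> related S b b'}"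

definition commutator1 :: "('f, 'a) alg \<Rightarrow> 'a rel \<Rightarrow> 'a rel \<Rightarrow> 'a rel" where
  "commutator1 \<A> R S = {(z, w). \<exists>x\<in>carrier \<A>. (x, x, z, w) \<in> matrices \<A> R S}\<^sup>+"

text \<open>Transitive closure is rendered by \<open>r\<^sup>+\<close>: the relation \<open>r\<^sup>*\<close> of the library would
  add the diagonal of the whole type, whereas all relations here live on the carrier.\<close>

definition cond_i :: "('f, 'a) alg \<Rightarrow> bool" where
  "cond_i \<A> \<longleftrightarrow> (\<forall>R. refl_compatible \<A> R \<longrightarrow> R \<subseteq> commutator1 \<A> R (tol \<A> R))"

definition cond_ia :: "('f, 'a) alg \<Rightarrow> bool" where
  "cond_ia \<A> \<longleftrightarrow> (\<forall>R. refl_compatible \<A> R \<longrightarrow> R\<^sup>+ \<subseteq> commutator1 \<A> R (tol \<A> R))"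

definition cond_ib :: "('f, 'a) alg \<Rightarrow> bool" where
  "cond_ib \<A> \<longleftrightarrow> (\<forall>R. refl_compatible \<A> R \<longrightarrow> R\<inverse> \<subseteq> commutator1 \<A> R (tol \<A> R))"

definition cond_ic :: "('f, 'a) alg \<Rightarrow> bool" where
  "cond_ic \<A> \<longleftrightarrow> (\<forall>R. refl_compatible \<A> R \<longrightarrow> tol \<A> R \<subseteq> commutator1 \<A> R (tol \<A> R))"

definition cond_id :: "('f, 'a) alg \<Rightarrow> bool" where
  "cond_id \<A> \<longleftrightarrow> (\<forall>R. refl_compatible \<A> R \<longrightarrow> Cg \<A> R = commutator1 \<A> R (tol \<A> R))"

definition cond_ii :: "('f, 'a) alg \<Rightarrow> bool" where
  "cond_ii \<A> \<longleftrightarrow>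
     (\<forall>T R. tolerance \<A> T \<longrightarrow> refl_compatible \<A> R \<longrightarrow> R \<inter> T \<subseteq> commutator1 \<A> R T)"

definition cond_iii :: "('f, 'a) alg \<Rightarrow> bool" where
  "cond_iii \<A> \<longleftrightarrow>
     (\<forall>T R1 R2. tolerance \<A> T \<longrightarrow> refl_compatible \<A> R1 \<longrightarrow> refl_compatible \<A> R2 \<longrightarrow>
        (R1 O R2) \<inter> T \<subseteq> (T \<inter> (R2\<inverse> O (T \<inter> (R1\<inverse> O R1)) O R2))\<^sup>+)"

definition cond_iv :: "('f, 'a) alg \<Rightarrow> bool" where
  "cond_iv \<A> \<longleftrightarrow>
     (\<forall>T R1 R2. tolerance \<A> T \<longrightarrow> refl_compatible \<A> R1 \<longrightarrow> refl_compatible \<A> R2 \<longrightarrow>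
        R1 \<inter> (T O R2) \<subseteq> (T \<inter> (R2 O (T \<inter> (R1\<inverse> O R1)) O R2\<inverse>))\<^sup>+ O R2)"

definition cond_v :: "('f, 'a) alg \<Rightarrow> bool" where
  "cond_v \<A> \<longleftrightarrow>
     (\<forall>\<beta> T S. congruence \<A> \<beta> \<longrightarrow> tolerance \<A> T \<longrightarrow> tolerance \<A> S \<longrightarrow>
        \<beta> \<inter> (T O S) \<subseteq> (T \<inter> (S O (T \<inter> \<beta>) O S))\<^sup>+ O S)"

definition cond_vi :: "('f, 'a) alg \<Rightarrow> bool" where
  "cond_vi \<A> \<longleftrightarrow>
     (\<forall>\<beta> \<gamma> T. congruence \<A> \<beta> \<longrightarrow> congruence \<A> \<gamma> \<longrightarrow> tolerance \<A> T \<longrightarrow>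
        \<beta> \<inter> (T O \<gamma>) \<subseteq> con_join \<A> \<gamma> ((T \<inter> \<beta>)\<^sup>+))"

lemma related_Inter:
  assumes "related (\<Inter> \<T>) xs ys" "R \<in> \<T>"
  shows "related R xs ys"
  using assms(1) by (rule list_all2_mono) (use assms(2) in blast)

lemma compatible_Inter:
  assumes "\<And>R. R \<in> \<T> \<Longrightarrow> compatible \<A> R" "\<T> \<noteq> {}"
  shows "compatible \<A> (\<Inter> \<T>)"
  unfolding compatible_def
proof (intro conjI ballI allI impI)
  show "\<Inter> \<T> \<subseteq> carrier \<A> \<times> carrier \<A>"
    using assms unfolding compatible_def by blast
next
  fix f xs ys
  assume *: "f \<in> symbols \<A>" "length xs = arity \<A> f" "related (\<Inter> \<T>) xs ys"
  show "(interp \<A> f xs, interp \<A> f ys) \<in> \<Inter> \<T>"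
  proof
    fix R assume "R \<in> \<T>"
    with * show "(interp \<A> f xs, interp \<A> f ys) \<in> R"
      using assms(1) related_Inter unfolding compatible_def by blast
  qed
qed

lemma congruence_full:
  assumes "algebra \<A>"
  shows "congruence \<A> (carrier \<A> \<times> carrier \<A>)"
proof -
  have *: "length ys = length xs \<and> set xs \<subseteq> carrier \<A> \<and> set ys \<subseteq> carrier \<A>"
    if "related (carrier \<A> \<times> carrier \<A>) xs ys" for xs ys
    using that by (induction rule: list_all2_induct) auto
  have "compatible \<A> (carrier \<A> \<times> carrier \<A>)"
    unfolding compatible_def
  proof (intro conjI ballI allI impI)
    fix f xs ys
    assume "f \<in> symbols \<A>" "length xs = arity \<A> f" "related (carrier \<A> \<times> carrier \<A>) xs ys"
    with *[of xs ys] assms show "(interp \<A> f xs, interp \<A> f ys) \<in> carrier \<A> \<times> carrier \<A>"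
      unfolding algebra_def by simp
  qed simp
  then show ?thesis
    unfolding congruence_def equiv_def by (auto simp: refl_on_def sym_def trans_def)
qed

lemma congruence_imp_tolerance: "congruence \<A> \<theta> \<Longrightarrow> tolerance \<A> \<theta>"
  unfolding congruence_def tolerance_def equiv_def by blast

lemma tol_least:
  assumes "algebra \<A>" "R \<subseteq> carrier \<A> \<times> carrier \<A>"
  shows "tolerance \<A> (tol \<A> R)" "R \<subseteq> tol \<A> R"
    and "\<And>T. tolerance \<A> T \<Longrightarrow> R \<subseteq> T \<Longrightarrow> tol \<A> R \<subseteq> T"
proof -
  have "{T. tolerance \<A> T \<and> R \<subseteq> T} \<noteq> {}"
    using congruence_imp_tolerance[OF congruence_full[OF assms(1)]] assms(2) by blast
  then have "compatible \<A> (tol \<A> R)"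
    unfolding tol_def by (intro compatible_Inter) (auto simp: tolerance_def)
  then show "tolerance \<A> (tol \<A> R)"
    unfolding tolerance_def by (auto simp: tol_def tolerance_def refl_on_def sym_def)
qed (auto simp: tol_def)

lemma Cg_least:
  assumes "algebra \<A>" "R \<subseteq> carrier \<A> \<times> carrier \<A>"
  shows "congruence \<A> (Cg \<A> R)" "R \<subseteq> Cg \<A> R"
    and "\<And>\<theta>. congruence \<A> \<theta> \<Longrightarrow> R \<subseteq> \<theta> \<Longrightarrow> Cg \<A> R \<subseteq> \<theta>"
proof -
  have "{\<theta>. congruence \<A> \<theta> \<and> R \<subseteq> \<theta>} \<noteq> {}"
    using congruence_full[OF assms(1)] assms(2) by blast
  then have c: "compatible \<A> (Cg \<A> R)"
    unfolding Cg_def by (intro compatible_Inter) (auto simp: congruence_def)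
  have "refl_on (carrier \<A>) (Cg \<A> R)" "sym (Cg \<A> R)"
    by (auto simp: Cg_def congruence_def equiv_def refl_on_def sym_def)
  moreover have "trans (Cg \<A> R)"
    unfolding Cg_def by (rule trans_INTER[where r = id, simplified]) (auto simp: congruence_def equiv_def)
  ultimately show "congruence \<A> (Cg \<A> R)"
    using c unfolding congruence_def equiv_def compatible_def by blast
qed (auto simp: Cg_def)

end

theory Submission
  imports Defs
begin

text \<open>The pairs \<open>(z, w)\<close> generating \<open>[R, T|1]\<close> form, for a tolerance \<open>T\<close>, a tolerance contained in
  \<open>T\<close>, so that \<open>[R, T|1]\<close> is a congruence below \<open>Cg T\<close>. For \<open>T = R\<degree>\<close> this makes (i) to (id) equivalent,
  and applying (i) to \<open>R \<inter> T\<close> gives (ii). For (iii), take a generating pair of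
  \<open>[R\<^sub>1 \<circ> R\<^sub>2, T|1]\<close> with \<open>a R\<^sub>1 e R\<^sub>2 a'\<close> componentwise: then \<open>t(e, b)\<close> and \<open>t(e, b')\<close> are
  \<open>T\<close>-related, both \<open>R\<^sub>1\<close>-above the common first-row value, and \<open>R\<^sub>2\<close>-below \<open>t(a', b)\<close> and
  \<open>t(a', b')\<close>. The remaining implications are specializations.\<close>

section \<open>Componentwise relations on lists\<close>

lemma related_refl: "refl_on A R \<Longrightarrow> set xs \<subseteq> A \<Longrightarrow> related R xs xs"
  by (auto simp: list_all2_same refl_on_def)

lemma related_set_subset:
  assumes "related R xs ys" "R \<subseteq> A \<times> A"
  shows "set xs \<subseteq> A" "set ys \<subseteq> A"
  using assms by (induction rule: list_all2_induct) auto

lemma related_converse: "related (R\<inverse>) xs ys \<longleftrightarrow> related R ys xs"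
  by (auto simp: list_all2_conv_all_nth)

lemma related_relcompE:
  assumes "related (R O S) xs ys"
  obtains es where "related R xs es" "related S es ys"
proof -
  have "\<exists>es. related R xs es \<and> related S es ys"
    using assms
  proof (induction rule: list_all2_induct)
    case (Cons x xs y ys)
    then obtain e es where "(x, e) \<in> R" "(e, y) \<in> S" "related R xs es" "related S es ys"
      by auto
    then have "related R (x # xs) (e # es) \<and> related S (e # es) (y # ys)" by simp
    then show ?case by blast
  qed simp
  then show thesis using that by blast
qed

text \<open>The chains in the several coordinates may differ in length, so they cannot be run in
  parallel. The coordinates are moved one after another instead, and reflexivity of \<open>R\<close>
  keeps all the others fixed meanwhile.\<close>

lemma related_trancl:
  assumes "refl_on A R" "R \<subseteq> A \<times> A" "related (R\<^sup>+) xs ys"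
  shows "(xs, ys) \<in> {(us, vs). related R us vs}\<^sup>+"
  using assms(3)
proof (induction rule: list_all2_induct)
  case Nil
  show ?case by (rule r_into_trancl) simp
next
  case (Cons x xs y ys)
  let ?Q = "{(us, vs). related R us vs}"
  have sub: "R\<^sup>+ \<subseteq> A \<times> A" using assms(2) by (rule trancl_subset_Sigma)
  have "set xs \<subseteq> A" using related_set_subset[OF Cons(2) sub] by simp
  then have xs: "related R xs xs" by (rule related_refl[OF assms(1)])
  have "(x, y) \<in> R\<^sup>+" by (rule Cons(1))
  \<comment> \<open>First the head runs along its chain over the resting tail \<open>xs\<close>;
    afterwards the tail moves under the resting head \<open>y\<close>.\<close>
  then have 1: "(x # xs, y # xs) \<in> ?Q\<^sup>+"
  proof (induction rule: trancl_induct)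
    case (base y)
    with xs show ?case by (intro r_into_trancl) simp
  next
    case (step y z)
    then have "(y # xs, z # xs) \<in> ?Q" using xs by simp
    with step.IH show ?case by (rule trancl_into_trancl)
  qed
  have yy: "(y, y) \<in> R" using Cons(1) sub assms(1) by (auto simp: refl_on_def)
  have "(y # us, y # vs) \<in> ?Q\<^sup>+" if "(us, vs) \<in> ?Q\<^sup>+" for us vs
    using that
  proof (induction rule: trancl_induct)
    case (base vs)
    with yy show ?case by (intro r_into_trancl) simp
  next
    case (step vs ws)
    with yy have "(y # vs, y # ws) \<in> ?Q" by simp
    with step.IH show ?case by (rule trancl_into_trancl)
  qed
  from 1 this[OF Cons.IH] show ?case by (rule trancl_trans)
qed

section \<open>Closure properties of compatible relations\<close>

lemma compatibleD:
  assumes "compatible \<A> R" "f \<in> symbols \<A>" "length xs = arity \<A> f" "related R xs ys"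
  shows "(interp \<A> f xs, interp \<A> f ys) \<in> R"
  using assms unfolding compatible_def by blast

lemma compatible_converse:
  assumes "compatible \<A> R"
  shows "compatible \<A> (R\<inverse>)"
  unfolding compatible_def related_converse
proof (intro conjI ballI allI impI)
  show "R\<inverse> \<subseteq> carrier \<A> \<times> carrier \<A>" using assms unfolding compatible_def by blast
next
  fix f xs ys
  assume "f \<in> symbols \<A>" "length xs = arity \<A> f" "related R ys xs"
  then show "(interp \<A> f xs, interp \<A> f ys) \<in> R\<inverse>"
    using compatibleD[OF assms] by (simp add: list_all2_lengthD)
qed

lemma compatible_relcomp:
  assumes "compatible \<A> R" "compatible \<A> S"
  shows "compatible \<A> (R O S)"
  unfolding compatible_def
proof (intro conjI ballI allI impI)
  show "R O S \<subseteq> carrier \<A> \<times> carrier \<A>" using assms unfolding compatible_def by blast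
next
  fix f xs ys
  assume f: "f \<in> symbols \<A>" "length xs = arity \<A> f" and "related (R O S) xs ys"
  then obtain es where es: "related R xs es" "related S es ys" by (elim related_relcompE)
  then have "length es = arity \<A> f" using f(2) by (simp add: list_all2_lengthD)
  with f es show "(interp \<A> f xs, interp \<A> f ys) \<in> R O S"
    using assms by (blast intro: compatibleD)
qed

lemma compatible_Int: "compatible \<A> R \<Longrightarrow> compatible \<A> S \<Longrightarrow> compatible \<A> (R \<inter> S)"
  using compatible_Inter[of "{R, S}" \<A>] by auto

lemma compatible_trancl:
  assumes "refl_on (carrier \<A>) R" "compatible \<A> R"
  shows "compatible \<A> (R\<^sup>+)"
proof -
  have sub: "R \<subseteq> carrier \<A> \<times> carrier \<A>" using assms(2) unfolding compatible_def by blast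
  have "(interp \<A> f xs, interp \<A> f ys) \<in> R\<^sup>+"
    if f: "f \<in> symbols \<A>" "length xs = arity \<A> f" and r: "related (R\<^sup>+) xs ys" for f xs ys
  proof -
    have "(xs, ys) \<in> {(us, vs). related R us vs}\<^sup>+"
      by (rule related_trancl[OF assms(1) sub r])
    \<comment> \<open>The length is carried through the induction because the next use of
      compatibility starts at the intermediate list \<open>ys\<close>.\<close>
    then have "length ys = arity \<A> f \<and> (interp \<A> f xs, interp \<A> f ys) \<in> R\<^sup>+"
    proof (induction rule: trancl_induct)
      case (base ys)
      then show ?case
        using compatibleD[OF assms(2) f] f(2) by (auto simp: list_all2_lengthD)
    next
      case (step ys zs)
      then have "length ys = length zs" by (auto dest: list_all2_lengthD)
      moreover have "(interp \<A> f ys, interp \<A> f zs) \<in> R"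
        using step compatibleD[OF assms(2) f(1)] by auto
      ultimately show ?case using step.IH by (auto intro: trancl_into_trancl)
    qed
    then show ?thesis by simp
  qed
  then show ?thesis
    using trancl_subset_Sigma[OF sub] unfolding compatible_def by blast
qed

lemma compatible_eval:
  assumes "compatible \<A> R" "is_term \<A> (length xs) t" "related R xs ys"
  shows "(eval \<A> xs t, eval \<A> ys t) \<in> R"
  using assms(2)
proof (induction t)
  case (Var i)
  then show ?case using list_all2_nthD[OF assms(3)] by simp
next
  case (App f ts)
  then have "related R (map (eval \<A> xs) ts) (map (eval \<A> ys) ts)"
    by (auto simp: list_all2_map1 list_all2_map2 list_all2_same)
  then show ?case using App.prems by (auto intro: compatibleD[OF assms(1)])
qed

lemma refl_compatible_subset: "refl_compatible \<A> R \<Longrightarrow> R \<subseteq> carrier \<A> \<times> carrier \<A>"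
  unfolding refl_compatible_def compatible_def by blast

lemma tolerance_imp_refl_compatible: "tolerance \<A> T \<Longrightarrow> refl_compatible \<A> T"
  unfolding tolerance_def refl_compatible_def by blast

lemma refl_compatible_Int:
  "refl_compatible \<A> R \<Longrightarrow> refl_compatible \<A> S \<Longrightarrow> refl_compatible \<A> (R \<inter> S)"
  unfolding refl_compatible_def by (simp add: compatible_Int refl_on_def)

lemma refl_compatible_relcomp:
  "refl_compatible \<A> R \<Longrightarrow> refl_compatible \<A> S \<Longrightarrow> refl_compatible \<A> (R O S)"
  unfolding refl_compatible_def by (auto simp: compatible_relcomp refl_on_def)

lemma refl_compatible_converse: "refl_compatible \<A> R \<Longrightarrow> refl_compatible \<A> (R\<inverse>)"
  unfolding refl_compatible_def by (simp add: compatible_converse)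

text \<open>Symmetry and compatibility survive transitive closure, the latter by reflexivity. This
  turns the tolerance of generating pairs into a congruence.\<close>

lemma tolerance_trancl_congruence:
  assumes "tolerance \<A> T"
  shows "congruence \<A> (T\<^sup>+)"
proof -
  have "compatible \<A> (T\<^sup>+)"
    using assms unfolding tolerance_def by (simp add: compatible_trancl)
  moreover have "refl_on (carrier \<A>) (T\<^sup>+)"
    using assms unfolding tolerance_def refl_on_def by blast
  moreover have "sym (T\<^sup>+)" using assms unfolding tolerance_def by (simp add: sym_trancl)
  ultimately show ?thesis
    unfolding congruence_def equiv_def by (simp add: compatible_def)
qed

lemma congruence_trancl_subset: "congruence \<A> \<theta> \<Longrightarrow> R \<subseteq> \<theta> \<Longrightarrow> R\<^sup>+ \<subseteq> \<theta>"
  using trancl_mono_subset[of R \<theta>] unfolding congruence_def equiv_def by (simp add: trancl_id)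

section \<open>Closure of the matrices under the basic operations\<close>

primrec rename :: "(nat \<Rightarrow> nat) \<Rightarrow> 'f trm \<Rightarrow> 'f trm" where
  "rename g (Var i) = Var (g i)"
| "rename g (App f ts) = App f (map (rename g) ts)"

lemma is_term_rename:
  assumes "is_term \<A> n t" "\<And>i. i < n \<Longrightarrow> g i < m"
  shows "is_term \<A> m (rename g t)"
  using assms(1) by (induction t) (auto simp: assms(2))

lemma eval_rename:
  assumes "is_term \<A> n t" "\<And>i. i < n \<Longrightarrow> ys ! g i = xs ! i"
  shows "eval \<A> ys (rename g t) = eval \<A> xs t"
  using assms(1)
proof (induction t)
  case (App f ts)
  then have "map (eval \<A> ys \<circ> rename g) ts = map (eval \<A> xs) ts" by auto
  then show ?case by (simp only: rename.simps eval.simps map_map)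
qed (simp add: assms(2))

text \<open>Finitely many matrices come with their own terms and their own argument lists, whereas
  \<open>App f\<close> evaluates all its subterms at the same arguments. Concatenating the row
  arguments and, separately, the column arguments gives common lists; each term is then renamed so
  that it reads only its own blocks.\<close>

lemma matrices_common_arguments:
  assumes "set ms \<subseteq> matrices \<A> R S"
  shows "\<exists>ts a a' b b'. related R a a' \<and> related S b b'
    \<and> (\<forall>t\<in>set ts. is_term \<A> (length a + length b) t)
    \<and> ms = map (\<lambda>t. (eval \<A> (a @ b) t, eval \<A> (a @ b') t,
                     eval \<A> (a' @ b) t, eval \<A> (a' @ b') t)) ts"
  using assms
proof (induction ms)
  case Nil
  show ?case by (intro exI[of _ "[]"]) simp
next
  case (Cons m ms)
  then obtain ts a a' b b' where IH: "related R a a'" "related S b b'"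
      "\<forall>t\<in>set ts. is_term \<A> (length a + length b) t"
      "ms = map (\<lambda>t. (eval \<A> (a @ b) t, eval \<A> (a @ b') t,
                     eval \<A> (a' @ b) t, eval \<A> (a' @ b') t)) ts"
    by auto
  from Cons.prems have "m \<in> matrices \<A> R S" by simp
  then obtain s c c' d d' where m: "is_term \<A> (length c + length d) s"
      "related R c c'" "related S d d'"
      "m = (eval \<A> (c @ d) s, eval \<A> (c @ d') s, eval \<A> (c' @ d) s, eval \<A> (c' @ d') s)"
    unfolding matrices_def by blast
  \<comment> \<open>The common list has the blocks \<open>c\<close>, \<open>a\<close>,
    \<open>d\<close>, \<open>b\<close> in this order. In passing from \<open>c @ d\<close>, the
    block \<open>d\<close> jumps over \<open>a\<close>; in passing from \<open>a @ b\<close>, the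
    block \<open>a\<close> jumps over \<open>c\<close>, and \<open>b\<close> over both
    \<open>c\<close> and \<open>d\<close>.\<close>
  define g where "g = (\<lambda>i. if i < length c then i else i + length a)"
  define h where "h = (\<lambda>i. if i < length a then i + length c else i + length c + length d)"
  let ?n = "length (c @ a) + length (d @ b)"
  have len: "length a' = length a" "length b' = length b" "length c' = length c" "length d' = length d"
    using IH(1,2) m(2,3) by (simp_all add: list_all2_lengthD)
  \<comment> \<open>The blocks are arbitrary up to their lengths, so that one fact serves all four
    entries of a matrix, with primed and unprimed lists mixed.\<close>
  have g: "eval \<A> ((u @ v) @ (w @ x)) (rename g s) = eval \<A> (u @ w) s"
    if "length u = length c" "length v = length a" "length w = length d" for u v w x
    by (rule eval_rename[OF m(1)]) (use that in \<open>auto simp: g_def nth_append\<close>)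
  have h: "eval \<A> ((u @ v) @ (w @ x)) (rename h t) = eval \<A> (v @ x) t"
    if "length u = length c" "length v = length a" "length w = length d" "t \<in> set ts" for u v w x t
    by (rule eval_rename[OF bspec[OF IH(3) that(4)]]) (use that in \<open>auto simp: h_def nth_append\<close>)
  have "is_term \<A> ?n (rename g s)"
    by (rule is_term_rename[OF m(1)]) (auto simp: g_def)
  moreover have "is_term \<A> ?n (rename h t)" if "t \<in> set ts" for t
    by (rule is_term_rename[OF bspec[OF IH(3) that]]) (auto simp: h_def)
  moreover have "related R (c @ a) (c' @ a')" "related S (d @ b) (d' @ b')"
    using IH(1,2) m(2,3) by (simp_all add: list_all2_appendI)
  moreover have "m # ms = map (\<lambda>t. (eval \<A> ((c @ a) @ (d @ b)) t, eval \<A> ((c @ a) @ (d' @ b')) t,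
      eval \<A> ((c' @ a') @ (d @ b)) t, eval \<A> ((c' @ a') @ (d' @ b')) t))
      (rename g s # map (rename h) ts)"
    using IH(4) m(4) by (simp add: g h len del: append_assoc)
  ultimately show ?case
    by (intro exI[of _ "rename g s # map (rename h) ts"] exI[of _ "c @ a"] exI[of _ "c' @ a'"]
        exI[of _ "d @ b"] exI[of _ "d' @ b'"]) (simp del: append_assoc)
qed

text \<open>Over common arguments the terms \<open>ts\<close> of the given matrices combine into the
  single term \<open>App f ts\<close>. Thus the matrices form a subalgebra of the fourth power of
  the algebra.\<close>

lemma matrices_interp:
  assumes "f \<in> symbols \<A>" "length ms = arity \<A> f" "set ms \<subseteq> matrices \<A> R S"
  shows "(interp \<A> f (map (\<lambda>(p, q, r, s). p) ms), interp \<A> f (map (\<lambda>(p, q, r, s). q) ms),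
          interp \<A> f (map (\<lambda>(p, q, r, s). r) ms), interp \<A> f (map (\<lambda>(p, q, r, s). s) ms))
         \<in> matrices \<A> R S"
proof -
  obtain ts a a' b b' where *: "related R a a'" "related S b b'"
      "\<forall>t\<in>set ts. is_term \<A> (length a + length b) t"
      "ms = map (\<lambda>t. (eval \<A> (a @ b) t, eval \<A> (a @ b') t,
                     eval \<A> (a' @ b) t, eval \<A> (a' @ b') t)) ts"
    using matrices_common_arguments[OF assms(3)] by blast
  have "is_term \<A> (length a + length b) (App f ts)"
    using *(3,4) assms(1,2) by simp
  with *(1,2) show ?thesis
    unfolding matrices_def *(4)
    by (intro CollectI exI[of _ "App f ts"] exI[of _ a] exI[of _ a'] exI[of _ b] exI[of _ b'])
      (simp add: comp_def)
qed

section \<open>The generating pairs of the commutator\<close>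

text \<open>The commutator before transitive closure, named separately because this relation itself
  is a tolerance when the second argument is one.\<close>

definition commutator_step :: "('f, 'a) alg \<Rightarrow> 'a rel \<Rightarrow> 'a rel \<Rightarrow> 'a rel" where
  "commutator_step \<A> R S = {(z, w). \<exists>x\<in>carrier \<A>. (x, x, z, w) \<in> matrices \<A> R S}"

lemma commutator1_eq: "commutator1 \<A> R S = (commutator_step \<A> R S)\<^sup>+"
  unfolding commutator1_def commutator_step_def ..

text \<open>Both entries of the second row share the list \<open>a'\<close>, so by reflexivity of
  \<open>S\<close> they are values of one term at \<open>S\<close>-related arguments.\<close>

lemma commutator_step_subset:
  assumes "refl_compatible \<A> R" "refl_compatible \<A> S"
  shows "commutator_step \<A> R S \<subseteq> S"
proof clarify
  fix z w assume "(z, w) \<in> commutator_step \<A> R S"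
  then obtain t a a' b b' where t: "is_term \<A> (length a + length b) t"
      "related R a a'" "related S b b'" "z = eval \<A> (a' @ b) t" "w = eval \<A> (a' @ b') t"
    unfolding commutator_step_def matrices_def by blast
  have "related S a' a'"
    using related_set_subset(2)[OF t(2) refl_compatible_subset[OF assms(1)]] assms(2)
    unfolding refl_compatible_def by (blast intro: related_refl)
  then have "related S (a' @ b) (a' @ b')" using t(3) by (rule list_all2_appendI)
  then show "(z, w) \<in> S"
    unfolding t(4,5) using assms(2) t(1,2)
    by (intro compatible_eval) (auto simp: refl_compatible_def list_all2_lengthD)
qed

text \<open>Constant matrices give reflexivity. Symmetry of \<open>T\<close> allows \<open>b\<close>
  and \<open>b'\<close> to be exchanged, which swaps the columns. An operation applied to matrices
  with constant first rows again yields a constant first row, which gives compatibility.\<close>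

lemma commutator_step_tolerance:
  assumes "algebra \<A>" "refl_compatible \<A> R" "tolerance \<A> T"
  shows "tolerance \<A> (commutator_step \<A> R T)"
  unfolding tolerance_def
proof (intro conjI)
  let ?K = "commutator_step \<A> R T"
  have "(x, x, x, x) \<in> matrices \<A> R T" if "x \<in> carrier \<A>" for x
  proof -
    have "related R [x] [x]" "related T [] []" "is_term \<A> (length [x] + length []) (Var 0)"
      using that assms(2) by (simp_all add: refl_compatible_def refl_on_def)
    moreover have "(x, x, x, x) = (eval \<A> ([x] @ []) (Var 0), eval \<A> ([x] @ []) (Var 0),
        eval \<A> ([x] @ []) (Var 0), eval \<A> ([x] @ []) (Var 0))" by simp
    ultimately show ?thesis unfolding matrices_def by blast
  qed
  then show "refl_on (carrier \<A>) ?K"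
    unfolding commutator_step_def refl_on_def by blast
  show "sym ?K"
  proof (rule symI)
    fix z w assume "(z, w) \<in> ?K"
    then obtain x t a a' b b' where t: "x \<in> carrier \<A>" "is_term \<A> (length a + length b) t"
        "related R a a'" "related T b b'" "x = eval \<A> (a @ b) t" "x = eval \<A> (a @ b') t"
        "z = eval \<A> (a' @ b) t" "w = eval \<A> (a' @ b') t"
      unfolding commutator_step_def matrices_def by blast
    have "related T b' b"
      using t(4) assms(3) unfolding tolerance_def by (simp add: list_all2_conv_all_nth symD)
    moreover have "length b' = length b" using t(4) by (simp add: list_all2_lengthD)
    ultimately have "(x, x, w, z) \<in> matrices \<A> R T"
      unfolding matrices_def using t(2,3,5-8)
      by (intro CollectI exI[of _ t] exI[of _ a] exI[of _ a'] exI[of _ b'] exI[of _ b]) simp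
    with t(1) show "(w, z) \<in> ?K" unfolding commutator_step_def by blast
  qed
  show "compatible \<A> ?K"
    unfolding compatible_def
  proof (intro conjI ballI allI impI)
    show "?K \<subseteq> carrier \<A> \<times> carrier \<A>"
      using commutator_step_subset[OF assms(2) tolerance_imp_refl_compatible[OF assms(3)]] assms(3)
      unfolding tolerance_def compatible_def by blast
  next
    fix f zs ws
    assume f: "f \<in> symbols \<A>" "length zs = arity \<A> f" and "related ?K zs ws"
    then have len: "length ws = length zs"
      and "\<forall>i<length zs. \<exists>x. x \<in> carrier \<A> \<and> (x, x, zs ! i, ws ! i) \<in> matrices \<A> R T"
      by (auto simp: list_all2_conv_all_nth commutator_step_def)
    \<comment> \<open>The common first-row value may differ from coordinate to coordinate;
      \<open>interp \<A> f\<close> applied to all these values gives the one for the resulting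
      matrix.\<close>
    then obtain x where x: "x i \<in> carrier \<A>" "(x i, x i, zs ! i, ws ! i) \<in> matrices \<A> R T"
      if "i < length zs" for i by metis
    let ?ms = "map (\<lambda>i. (x i, x i, zs ! i, ws ! i)) [0..<length zs]"
    let ?xs = "map x [0..<length zs]"
    have "set ?ms \<subseteq> matrices \<A> R T" using x(2) by auto
    from matrices_interp[OF f(1) _ this]
    have "(interp \<A> f ?xs, interp \<A> f ?xs, interp \<A> f zs, interp \<A> f ws) \<in> matrices \<A> R T"
      using f(2) map_nth[of zs] map_nth[of ws] len by (simp add: comp_def)
    moreover have "interp \<A> f ?xs \<in> carrier \<A>"
    proof -
      have "set ?xs \<subseteq> carrier \<A>" using x(1) by auto
      then show ?thesis using assms(1) f unfolding algebra_def by simp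
    qed
    ultimately show "(interp \<A> f zs, interp \<A> f ws) \<in> ?K"
      unfolding commutator_step_def by blast
  qed
qed

lemma commutator1_congruence:
  assumes "algebra \<A>" "refl_compatible \<A> R" "tolerance \<A> T"
  shows "congruence \<A> (commutator1 \<A> R T)"
  unfolding commutator1_eq
  by (rule tolerance_trancl_congruence[OF commutator_step_tolerance[OF assms]])

lemma matrices_mono:
  assumes "R \<subseteq> R'" "S \<subseteq> S'"
  shows "matrices \<A> R S \<subseteq> matrices \<A> R' S'"
proof -
  have "related R xs ys \<Longrightarrow> related R' xs ys" "related S xs ys \<Longrightarrow> related S' xs ys" for xs ys
    using assms by (auto elim!: list_all2_mono)
  then show ?thesis unfolding matrices_def by blast
qed

lemma commutator1_mono:
  assumes "R \<subseteq> R'" "S \<subseteq> S'"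
  shows "commutator1 \<A> R S \<subseteq> commutator1 \<A> R' S'"
  unfolding commutator1_eq commutator_step_def
  using matrices_mono[OF assms] by (intro trancl_mono_subset) blast

text \<open>The intermediate list \<open>e\<close> inserts a middle row \<open>t(e, b)\<close>,
  \<open>t(e, b')\<close> into the matrix. Its entries are \<open>T\<close>-related, since only
  \<open>b\<close> changes to \<open>b'\<close>, and both lie \<open>R1\<close>-above
  \<open>x\<close>, since the two first-row entries coincide. \<open>R2\<close> leads from the
  middle row down to \<open>z\<close> and \<open>w\<close>.\<close>

lemma commutator_step_relcomp_subset:
  assumes T: "tolerance \<A> T" and R: "refl_compatible \<A> R1" "refl_compatible \<A> R2"
  shows "commutator_step \<A> (R1 O R2) T \<subseteq> T \<inter> (R2\<inverse> O (T \<inter> (R1\<inverse> O R1)) O R2)"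
proof clarify
  fix z w assume zw: "(z, w) \<in> commutator_step \<A> (R1 O R2) T"
  then obtain x t a a' b b' where t: "is_term \<A> (length a + length b) t"
      "related (R1 O R2) a a'" "related T b b'" "x = eval \<A> (a @ b) t" "x = eval \<A> (a @ b') t"
      "z = eval \<A> (a' @ b) t" "w = eval \<A> (a' @ b') t"
    unfolding commutator_step_def matrices_def by blast
  from t(2) obtain e where e: "related R1 a e" "related R2 e a'" by (rule related_relcompE)
  have comp: "compatible \<A> T" "compatible \<A> R1" "compatible \<A> R2"
    and refl: "refl_on (carrier \<A>) T" "refl_on (carrier \<A>) R1" "refl_on (carrier \<A>) R2"
    using T R unfolding tolerance_def refl_compatible_def by auto
  have len: "length e = length a" "length b' = length b"
    using e t(3) by (simp_all add: list_all2_lengthD)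
  have sub: "T \<subseteq> carrier \<A> \<times> carrier \<A>" "R1 \<subseteq> carrier \<A> \<times> carrier \<A>"
    using comp unfolding compatible_def by auto
  have set: "set e \<subseteq> carrier \<A>" "set b \<subseteq> carrier \<A>" "set b' \<subseteq> carrier \<A>"
    using related_set_subset[OF e(1) sub(2)] related_set_subset[OF t(3) sub(1)] by auto
  have "(x, eval \<A> (e @ b) t) \<in> R1" "(x, eval \<A> (e @ b') t) \<in> R1"
    using t(1,4,5) len compatible_eval[OF comp(2), of "a @ b" t "e @ b"]
      compatible_eval[OF comp(2), of "a @ b'" t "e @ b'"] e(1) set refl
    by (simp_all add: list_all2_appendI related_refl)
  moreover have "(eval \<A> (e @ b) t, z) \<in> R2" "(eval \<A> (e @ b') t, w) \<in> R2"
    using t(1,6,7) len compatible_eval[OF comp(3), of "e @ b" t "a' @ b"]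
      compatible_eval[OF comp(3), of "e @ b'" t "a' @ b'"] e(2) set refl
    by (simp_all add: list_all2_appendI related_refl)
  moreover have "(eval \<A> (e @ b) t, eval \<A> (e @ b') t) \<in> T"
    using t(1,3) len set refl
    by (intro compatible_eval[OF comp(1)]) (simp_all add: list_all2_appendI related_refl)
  moreover have "(z, w) \<in> T"
    using zw commutator_step_subset[OF refl_compatible_relcomp[OF R] tolerance_imp_refl_compatible[OF T]]
    by blast
  ultimately show "(z, w) \<in> T \<inter> (R2\<inverse> O (T \<inter> (R1\<inverse> O R1)) O R2)" by blast
qed

section \<open>Implications between the conditions\<close>

context
  fixes \<A> :: "('f, 'a) alg"
  assumes alg: "algebra \<A>"
begin

lemma tol_subset_Cg: "R \<subseteq> carrier \<A> \<times> carrier \<A> \<Longrightarrow> tol \<A> R \<subseteq> Cg \<A> R"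
  by (intro tol_least(3)[OF alg] congruence_imp_tolerance Cg_least(1,2)[OF alg])

lemma commutator1_tol_congruence:
  assumes "refl_compatible \<A> R"
  shows "congruence \<A> (commutator1 \<A> R (tol \<A> R))"
  by (rule commutator1_congruence[OF alg assms tol_least(1)[OF alg refl_compatible_subset[OF assms]]])

text \<open>The generating pairs lie in \<open>tol \<A> R\<close>, hence in
  \<open>Cg \<A> R\<close>, which is transitive. This half of \<open>cond_id\<close> therefore holds
  in every algebra.\<close>

lemma commutator1_tol_subset_Cg:
  assumes "refl_compatible \<A> R"
  shows "commutator1 \<A> R (tol \<A> R) \<subseteq> Cg \<A> R"
proof -
  note sub = refl_compatible_subset[OF assms]
  have "commutator_step \<A> R (tol \<A> R) \<subseteq> tol \<A> R"
    using commutator_step_subset[OF assms tolerance_imp_refl_compatible[OF tol_least(1)[OF alg sub]]] .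
  then show ?thesis
    unfolding commutator1_eq
    using congruence_trancl_subset[OF Cg_least(1)[OF alg sub]] tol_subset_Cg[OF sub] by blast
qed

text \<open>The commutator is a congruence, so as soon as it contains \<open>R\<close> it contains
  \<open>Cg \<A> R\<close>.\<close>

lemma cond_i_imp_cond_id: "cond_i \<A> \<Longrightarrow> cond_id \<A>"
  unfolding cond_i_def cond_id_def
  by (intro allI impI subset_antisym commutator1_tol_subset_Cg
      Cg_least(3)[OF alg refl_compatible_subset commutator1_tol_congruence]) simp_all

lemma cond_id_imp_cond_ia: "cond_id \<A> \<Longrightarrow> cond_ia \<A>"
  unfolding cond_id_def cond_ia_def
proof (intro allI impI)
  fix R
  assume *: "\<forall>R. refl_compatible \<A> R \<longrightarrow> Cg \<A> R = commutator1 \<A> R (tol \<A> R)"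
    "refl_compatible \<A> R"
  have "R\<^sup>+ \<subseteq> Cg \<A> R"
    using congruence_trancl_subset Cg_least(1,2)[OF alg refl_compatible_subset[OF *(2)]] .
  with * show "R\<^sup>+ \<subseteq> commutator1 \<A> R (tol \<A> R)" by simp
qed

lemma cond_id_imp_cond_ib: "cond_id \<A> \<Longrightarrow> cond_ib \<A>"
  unfolding cond_id_def cond_ib_def
proof clarify
  fix R x y
  assume *: "\<forall>R. refl_compatible \<A> R \<longrightarrow> Cg \<A> R = commutator1 \<A> R (tol \<A> R)"
    "refl_compatible \<A> R" "(x, y) \<in> R"
  then have "(x, y) \<in> Cg \<A> R" "sym (Cg \<A> R)"
    using Cg_least(1,2)[OF alg refl_compatible_subset[OF *(2)]]
    unfolding congruence_def equiv_def by auto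
  then show "(y, x) \<in> commutator1 \<A> R (tol \<A> R)" using * by (auto dest: symD)
qed

lemma cond_id_imp_cond_ic: "cond_id \<A> \<Longrightarrow> cond_ic \<A>"
  unfolding cond_id_def cond_ic_def
proof (intro allI impI)
  fix R
  assume *: "\<forall>R. refl_compatible \<A> R \<longrightarrow> Cg \<A> R = commutator1 \<A> R (tol \<A> R)"
    "refl_compatible \<A> R"
  have "tol \<A> R \<subseteq> Cg \<A> R" by (rule tol_subset_Cg[OF refl_compatible_subset[OF *(2)]])
  with * show "tol \<A> R \<subseteq> commutator1 \<A> R (tol \<A> R)" by simp
qed

lemma cond_ia_imp_cond_i: "cond_ia \<A> \<Longrightarrow> cond_i \<A>"
  unfolding cond_ia_def cond_i_def
proof (intro allI impI)
  fix R
  assume *: "\<forall>R. refl_compatible \<A> R \<longrightarrow> R\<^sup>+ \<subseteq> commutator1 \<A> R (tol \<A> R)"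
    "refl_compatible \<A> R"
  have "R \<subseteq> R\<^sup>+" by auto
  also have "\<dots> \<subseteq> commutator1 \<A> R (tol \<A> R)" using * by simp
  finally show "R \<subseteq> commutator1 \<A> R (tol \<A> R)" .
qed

text \<open>The commutator is symmetric, so it contains \<open>R\<close> along with its
  converse.\<close>

lemma cond_ib_imp_cond_i: "cond_ib \<A> \<Longrightarrow> cond_i \<A>"
  unfolding cond_ib_def cond_i_def
proof clarify
  fix R x y
  assume *: "\<forall>R. refl_compatible \<A> R \<longrightarrow> R\<inverse> \<subseteq> commutator1 \<A> R (tol \<A> R)"
    "refl_compatible \<A> R" "(x, y) \<in> R"
  then have "(y, x) \<in> commutator1 \<A> R (tol \<A> R)" by blast
  then show "(x, y) \<in> commutator1 \<A> R (tol \<A> R)"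
    using commutator1_tol_congruence[OF *(2)] unfolding congruence_def equiv_def by (blast dest: symD)
qed

lemma cond_ic_imp_cond_i: "cond_ic \<A> \<Longrightarrow> cond_i \<A>"
  unfolding cond_ic_def cond_i_def
proof (intro allI impI)
  fix R
  assume *: "\<forall>R. refl_compatible \<A> R \<longrightarrow> tol \<A> R \<subseteq> commutator1 \<A> R (tol \<A> R)"
    "refl_compatible \<A> R"
  have "R \<subseteq> tol \<A> R" by (rule tol_least(2)[OF alg refl_compatible_subset[OF *(2)]])
  also have "\<dots> \<subseteq> commutator1 \<A> R (tol \<A> R)" using * by simp
  finally show "R \<subseteq> commutator1 \<A> R (tol \<A> R)" .
qed

lemma cond_i_imp_cond_ii:
  assumes "cond_i \<A>"
  shows "cond_ii \<A>"
  unfolding cond_ii_def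
proof (intro allI impI)
  fix T R assume *: "tolerance \<A> T" "refl_compatible \<A> R"
  have rc: "refl_compatible \<A> (R \<inter> T)"
    using * by (simp add: refl_compatible_Int tolerance_imp_refl_compatible)
  then have "R \<inter> T \<subseteq> commutator1 \<A> (R \<inter> T) (tol \<A> (R \<inter> T))"
    using assms unfolding cond_i_def by blast
  \<comment> \<open>As \<open>T\<close> is a tolerance above \<open>R \<inter> T\<close>, it also
    contains the tolerance generated by \<open>R \<inter> T\<close>; monotonicity in both arguments
    then applies.\<close>
  also have "\<dots> \<subseteq> commutator1 \<A> R T"
    using tol_least(3)[OF alg refl_compatible_subset[OF rc] *(1)] by (intro commutator1_mono) auto
  finally show "R \<inter> T \<subseteq> commutator1 \<A> R T" .
qed

text \<open>The choice \<open>T = tol \<A> R\<close> makes the intersection with \<open>R\<close>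
  equal to \<open>R\<close>.\<close>

lemma cond_ii_imp_cond_i: "cond_ii \<A> \<Longrightarrow> cond_i \<A>"
  unfolding cond_ii_def cond_i_def
proof (intro allI impI)
  fix R
  assume *: "\<forall>T R. tolerance \<A> T \<longrightarrow> refl_compatible \<A> R \<longrightarrow> R \<inter> T \<subseteq> commutator1 \<A> R T"
    "refl_compatible \<A> R"
  note tol = tol_least(1,2)[OF alg refl_compatible_subset[OF *(2)]]
  have "R \<inter> tol \<A> R \<subseteq> commutator1 \<A> R (tol \<A> R)" using *(1)[rule_format, OF tol(1) *(2)] .
  with tol(2) show "R \<subseteq> commutator1 \<A> R (tol \<A> R)" by blast
qed

lemma cond_ii_imp_cond_iii:
  assumes "cond_ii \<A>"
  shows "cond_iii \<A>"
  unfolding cond_iii_def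
proof (intro allI impI)
  fix T R1 R2
  assume *: "tolerance \<A> T" "refl_compatible \<A> R1" "refl_compatible \<A> R2"
  have "(R1 O R2) \<inter> T \<subseteq> commutator1 \<A> (R1 O R2) T"
    using assms * refl_compatible_relcomp unfolding cond_ii_def by blast
  also have "\<dots> \<subseteq> (T \<inter> (R2\<inverse> O (T \<inter> (R1\<inverse> O R1)) O R2))\<^sup>+"
    unfolding commutator1_eq by (rule trancl_mono_subset[OF commutator_step_relcomp_subset[OF *]])
  finally show "(R1 O R2) \<inter> T \<subseteq> \<dots>" .
qed

text \<open>Let \<open>(p, r)\<close> lie in \<open>R1\<close>, with \<open>(p, q)\<close> in
  \<open>T\<close> and \<open>(q, r)\<close> in \<open>R2\<close>. Then \<open>(p, q)\<close> lies
  in both \<open>R1 O R2\<inverse>\<close> and \<open>T\<close>, so \<open>cond_iii\<close> for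
  \<open>R1\<close> and \<open>R2\<inverse>\<close> gives a chain from \<open>p\<close> to
  \<open>q\<close>, and the step from \<open>q\<close> to \<open>r\<close> supplies the final factor
  \<open>R2\<close>.\<close>

lemma cond_iii_imp_cond_iv:
  assumes "cond_iii \<A>"
  shows "cond_iv \<A>"
  unfolding cond_iv_def
proof (intro allI impI)
  fix T R1 R2
  assume *: "tolerance \<A> T" "refl_compatible \<A> R1" "refl_compatible \<A> R2"
  have "(R1 O R2\<inverse>) \<inter> T \<subseteq> (T \<inter> ((R2\<inverse>)\<inverse> O (T \<inter> (R1\<inverse> O R1)) O R2\<inverse>))\<^sup>+"
    using assms * refl_compatible_converse unfolding cond_iii_def by blast
  then show "R1 \<inter> (T O R2) \<subseteq> (T \<inter> (R2 O (T \<inter> (R1\<inverse> O R1)) O R2\<inverse>))\<^sup>+ O R2"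
    unfolding converse_converse by blast
qed

text \<open>For \<open>R1 = \<beta>\<close> and \<open>R2 = S\<close> the converses disappear,
  because \<open>\<beta>\<inverse> O \<beta> = \<beta>\<close> for an equivalence and
  \<open>S\<close> is symmetric.\<close>

lemma cond_iv_imp_cond_v:
  assumes "cond_iv \<A>"
  shows "cond_v \<A>"
  unfolding cond_v_def
proof (intro allI impI)
  fix \<beta> T S
  assume *: "congruence \<A> \<beta>" "tolerance \<A> T" "tolerance \<A> S"
  then have "\<beta> \<inter> (T O S) \<subseteq> (T \<inter> (S O (T \<inter> (\<beta>\<inverse> O \<beta>)) O S\<inverse>))\<^sup>+ O S"
    using assms tolerance_imp_refl_compatible congruence_imp_tolerance unfolding cond_iv_def by blast
  moreover have "\<beta>\<inverse> O \<beta> = \<beta>"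
    using *(1) unfolding congruence_def by (blast dest: equiv_comp_eq)
  moreover have "S\<inverse> = S" using *(3) unfolding tolerance_def by (simp add: sym_conv_converse_eq)
  ultimately show "\<beta> \<inter> (T O S) \<subseteq> (T \<inter> (S O (T \<inter> \<beta>) O S))\<^sup>+ O S" by simp
qed

text \<open>With \<open>S = \<gamma>\<close>, every factor on the right-hand side of
  \<open>cond_v\<close> lies in the join, and the join is transitive.\<close>

lemma cond_v_imp_cond_vi:
  assumes "cond_v \<A>"
  shows "cond_vi \<A>"
  unfolding cond_vi_def con_join_def
proof (intro allI impI)
  fix \<beta> \<gamma> T
  assume *: "congruence \<A> \<beta>" "congruence \<A> \<gamma>" "tolerance \<A> T"
  let ?\<theta> = "Cg \<A> (\<gamma> \<union> (T \<inter> \<beta>)\<^sup>+)"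
  have "\<gamma> \<union> (T \<inter> \<beta>)\<^sup>+ \<subseteq> carrier \<A> \<times> carrier \<A>"
    using * trancl_subset_Sigma[of "T \<inter> \<beta>" "carrier \<A>"]
    unfolding congruence_def tolerance_def compatible_def by blast
  note \<theta> = Cg_least(1,2)[OF alg this]
  have sub: "\<gamma> \<subseteq> ?\<theta>" "T \<inter> \<beta> \<subseteq> ?\<theta>"
    using \<theta>(2) by auto
  have tr: "trans ?\<theta>" using \<theta>(1) unfolding congruence_def equiv_def by blast
  have "T \<inter> (\<gamma> O (T \<inter> \<beta>) O \<gamma>) \<subseteq> ?\<theta>"
    using sub tr by (blast dest: transD)
  then have "(T \<inter> (\<gamma> O (T \<inter> \<beta>) O \<gamma>))\<^sup>+ \<subseteq> ?\<theta>" by (rule congruence_trancl_subset[OF \<theta>(1)])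
  then have "(T \<inter> (\<gamma> O (T \<inter> \<beta>) O \<gamma>))\<^sup>+ O \<gamma> \<subseteq> ?\<theta>"
    using sub(1) tr by (blast dest: transD)
  then show "\<beta> \<inter> (T O \<gamma>) \<subseteq> ?\<theta>"
    using assms * congruence_imp_tolerance unfolding cond_v_def by blast
qed

end

theorem theorem2:
  fixes \<A> :: "('f, 'a) alg"
  assumes "algebra \<A>"
  shows "sorted_wrt (\<lambda>P Q. P \<longrightarrow> Q)
           [cond_i \<A>, cond_ia \<A>, cond_ib \<A>, cond_ic \<A>, cond_id \<A>, cond_ii \<A>,
            cond_iii \<A>, cond_iv \<A>, cond_v \<A>, cond_vi \<A>]
       \<and> (cond_i \<A> \<longleftrightarrow> cond_ia \<A>) \<and> (cond_i \<A> \<longleftrightarrow> cond_ib \<A>) \<and> (cond_i \<A> \<longleftrightarrow> cond_ic \<A>)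
       \<and> (cond_i \<A> \<longleftrightarrow> cond_id \<A>) \<and> (cond_i \<A> \<longleftrightarrow> cond_ii \<A>)"
proof -
  have eq: "cond_i \<A> \<longleftrightarrow> cond_ia \<A>" "cond_i \<A> \<longleftrightarrow> cond_ib \<A>" "cond_i \<A> \<longleftrightarrow> cond_ic \<A>"
    "cond_i \<A> \<longleftrightarrow> cond_id \<A>" "cond_i \<A> \<longleftrightarrow> cond_ii \<A>"
    using cond_i_imp_cond_id[OF assms] cond_id_imp_cond_ia[OF assms] cond_id_imp_cond_ib[OF assms]
      cond_id_imp_cond_ic[OF assms] cond_ia_imp_cond_i[OF assms] cond_ib_imp_cond_i[OF assms]
      cond_ic_imp_cond_i[OF assms] cond_i_imp_cond_ii[OF assms] cond_ii_imp_cond_i[OF assms]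
    by blast+
  moreover have "cond_ii \<A> \<longrightarrow> cond_iii \<A>" "cond_iii \<A> \<longrightarrow> cond_iv \<A>" "cond_iv \<A> \<longrightarrow> cond_v \<A>"
    "cond_v \<A> \<longrightarrow> cond_vi \<A>"
    using cond_ii_imp_cond_iii[OF assms] cond_iii_imp_cond_iv[OF assms] cond_iv_imp_cond_v[OF assms]
      cond_v_imp_cond_vi[OF assms] by blast+
  \<comment> \<open>\<open>sorted_wrt\<close> asks for an implication between every two conditions
    in the list order. The equivalences settle the pairs among the first six; the chain starting at
    \<open>cond_ii\<close> settles the rest.\<close>
  ultimately show ?thesis by auto
qed

end
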